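(* Let $B$ be a finite skew brace such that the group $(B,\cdot)$ is abelian. Then $B$ is solvable.
   Context: A skew brace is a triple $B=(B,+,\cdot)$ such that $(B,+)$ and $(B,\cdot)$ are groups (neither assumed abelian in general) on the same underlying set and $a\cdot(b+c)=a\cdot b-a+a\cdot c$ for all $a,b,c\in B$. The two identity elements coincide and are denoted by $0$. For $a\in B$, $\lambda_a(b)=-a+a\cdot b$ defines an automorphism of $(B,+)$. A left ideal of $B$ is a subgroup $I\leq (B,+)$ with $\lambda_b(I)=I$ for every $b\in B$. An ideal of $B$ is a left ideal that is normal in both $(B,+)$ and $(B,\cdot)$. For ideals $I,J$ of $B$, the commutator $[I,J]_B$ is the ideal of $B$ generated by $[I,J]_+\cup[I,J]_\cdot\cup\{\,i\cdot j-(i+j)\mid i\in I,\ j\in J\,\}$, where $[I,J]_+$ and $[I,J]_\cdot$ are the commutator subgroups taken in $(B,+)$ and $(B,\cdot)$. The derived series of $B$ is $\partial^0(B)=B$, $\partial^{n+1}(B)=[\partial^n(B),\partial^n(B)]_B$. The skew brace $B$ is solvable if $\partial^n(B)=0$ for some $n\geq 0$. *)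

theory Defs
  imports "HOL-Algebra.Generated_Groups" "HOL-Algebra.Ring"
begin

text \<open>
  A skew brace is carried by a \<open>ring\<close> record, whose two operations are taken without
  commutativity or two-sided distributivity. Read as a monoid, the record \<open>B\<close> itself is
  the group \<open>(B, \<cdot>)\<close>, and \<open>add_monoid B\<close> is the group \<open>(B, +)\<close>. The record has separate
  fields for \<open>\<zero>\<close> and \<open>\<one>\<close>; that they coincide follows from the axioms (\<open>one_eq_zero\<close>).
\<close>

locale skew_brace = group B for B (structure) +
  assumes add_group: "group (add_monoid B)"
    and brace_distrib:
      "\<lbrakk>a \<in> carrier B; b \<in> carrier B; c \<in> carrier B\<rbrakk>
        \<Longrightarrow> a \<otimes> (b \<oplus> c) = ((a \<otimes> b) \<ominus> a) \<oplus> (a \<otimes> c)"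

definition brace_lambda :: "('a, 'm) ring_scheme \<Rightarrow> 'a \<Rightarrow> 'a \<Rightarrow> 'a" where
  "brace_lambda B a b = (\<ominus>\<^bsub>B\<^esub> a) \<oplus>\<^bsub>B\<^esub> (a \<otimes>\<^bsub>B\<^esub> b)"

definition brace_left_ideal :: "('a, 'm) ring_scheme \<Rightarrow> 'a set \<Rightarrow> bool" where
  "brace_left_ideal B I \<longleftrightarrow>
    subgroup I (add_monoid B) \<and> (\<forall>b \<in> carrier B. brace_lambda B b ` I = I)"

definition brace_ideal :: "('a, 'm) ring_scheme \<Rightarrow> 'a set \<Rightarrow> bool" where
  "brace_ideal B I \<longleftrightarrow> brace_left_ideal B I \<and> I \<lhd> add_monoid B \<and> I \<lhd> B"

definition brace_ideal_generated :: "('a, 'm) ring_scheme \<Rightarrow> 'a set \<Rightarrow> 'a set" where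
  "brace_ideal_generated B S = \<Inter>{I. brace_ideal B I \<and> S \<subseteq> I}"

text \<open>The two-argument form of \<^const>\<open>derived\<close>: \<open>commutator_subgroup G H H = derived G H\<close>.\<close>

definition commutator_subgroup ::
    "('a, 'm) monoid_scheme \<Rightarrow> 'a set \<Rightarrow> 'a set \<Rightarrow> 'a set" where
  "commutator_subgroup G H K =
    generate G (\<Union>h \<in> H. \<Union>k \<in> K. {h \<otimes>\<^bsub>G\<^esub> k \<otimes>\<^bsub>G\<^esub> (inv\<^bsub>G\<^esub> h) \<otimes>\<^bsub>G\<^esub> (inv\<^bsub>G\<^esub> k)})"

definition brace_commutator ::
    "('a, 'm) ring_scheme \<Rightarrow> 'a set \<Rightarrow> 'a set \<Rightarrow> 'a set" where
  "brace_commutator B I J = brace_ideal_generated B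
    (commutator_subgroup (add_monoid B) I J \<union> commutator_subgroup B I J \<union>
     {(i \<otimes>\<^bsub>B\<^esub> j) \<ominus>\<^bsub>B\<^esub> (i \<oplus>\<^bsub>B\<^esub> j) | i j. i \<in> I \<and> j \<in> J})"

primrec brace_derived_series :: "('a, 'm) ring_scheme \<Rightarrow> nat \<Rightarrow> 'a set" where
  "brace_derived_series B 0 = carrier B"
| "brace_derived_series B (Suc n) =
    brace_commutator B (brace_derived_series B n) (brace_derived_series B n)"

definition brace_solvable :: "('a, 'm) ring_scheme \<Rightarrow> bool" where
  "brace_solvable B \<longleftrightarrow> (\<exists>n. brace_derived_series B n = {\<zero>\<^bsub>B\<^esub>})"

lemma commutator_subgroup_self: "commutator_subgroup G H H = derived G H"
  by (simp add: commutator_subgroup_def derived_def)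

context skew_brace
begin

sublocale add: group "add_monoid B"
  rewrites "carrier (add_monoid B) = carrier B"
    and "mult (add_monoid B) = add B"
    and "one (add_monoid B) = zero B"
    and "m_inv (add_monoid B) = a_inv B"
  by (rule add_group) (auto simp: a_inv_def)

lemma one_eq_zero: "\<one> = \<zero>"
proof -
  have "\<zero> = (\<zero> \<ominus> \<one>) \<oplus> \<zero>"
    using brace_distrib[of \<one> \<zero> \<zero>] by simp
  then have "\<zero> = \<ominus> \<one>"
    by (simp add: a_minus_def)
  then show ?thesis
    by (metis add.inv_inv add.inv_one one_closed)
qed

lemma brace_lambda_closed:
  "\<lbrakk>a \<in> carrier B; b \<in> carrier B\<rbrakk> \<Longrightarrow> brace_lambda B a b \<in> carrier B"
  by (simp add: brace_lambda_def)

lemma brace_lambda_add: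
  "\<lbrakk>a \<in> carrier B; b \<in> carrier B; c \<in> carrier B\<rbrakk>
    \<Longrightarrow> brace_lambda B a (b \<oplus> c) = brace_lambda B a b \<oplus> brace_lambda B a c"
  by (simp add: brace_lambda_def brace_distrib a_minus_def add.m_assoc)

lemma brace_lambda_image_carrier:
  assumes "a \<in> carrier B"
  shows "brace_lambda B a ` carrier B = carrier B"
proof
  show "brace_lambda B a ` carrier B \<subseteq> carrier B"
    using assms brace_lambda_closed by auto
  show "carrier B \<subseteq> brace_lambda B a ` carrier B"
  proof
    fix c assume c: "c \<in> carrier B"
    have "a \<otimes> (inv a \<otimes> (a \<oplus> c)) = a \<oplus> c"
      using assms c by (simp add: m_assoc[symmetric])
    then have "brace_lambda B a (inv a \<otimes> (a \<oplus> c)) = c"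
      using assms c by (simp add: brace_lambda_def add.m_assoc[symmetric])
    then show "c \<in> brace_lambda B a ` carrier B"
      using assms c by (metis imageI add.m_closed inv_closed m_closed)
  qed
qed

lemma brace_ideal_carrier: "brace_ideal B (carrier B)"
  unfolding brace_ideal_def brace_left_ideal_def
  using brace_lambda_image_carrier add.subgroup_self add.normal_inv_iff normal_inv_iff
    subgroup_self
  by auto

end

end

theory Submission
  imports Defs
begin

text \<open>
  Write \<open>a \<star> b = \<lambda>\<^sub>a(b) - b\<close>. For an ideal \<open>I\<close>, the additive subgroup \<open>I \<star> I\<close> generated by all
  \<open>i \<star> j\<close> is again an ideal of \<open>B\<close> and contains \<open>[I, I]\<^sub>B\<close>, because commutativity of
  \<open>(B, \<cdot>)\<close> forces \<open>i + j\<close> and \<open>j + i\<close> to agree modulo \<open>I \<star> I\<close>. So it suffices that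
  \<open>I \<star> I \<noteq> I\<close> for \<open>I \<noteq> 0\<close>, and one may regard \<open>I\<close> itself as the skew brace.
  The semidirect product of \<open>(B, +)\<close> with \<open>\<lambda>(B)\<close> is a product of the abelian subgroups
  \<open>{(a, \<lambda>\<^sub>a)}\<close> and \<open>\<lambda>(B)\<close>; the commutators of elements of these are the \<open>a \<star> b\<close>, which
  therefore commute with each other by Ito's argument. If \<open>B \<star> B = B\<close>, then \<open>(B, +)\<close> is abelian
  and \<open>B\<close> is a finite commutative radical ring with product \<open>\<star>\<close>. Modulo a maximal proper ideal
  such a ring would have a unit \<open>e\<close>, contradicting the bijectivity of \<open>\<lambda>\<^bsub>-e\<^esub>\<close>.
\<close>

locale comm_skew_brace = skew_brace + comm_group B

section \<open>Identities for \<lambda> and \<open>\<star>\<close> in an arbitrary skew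
  brace\<close>

context skew_brace
begin

lemma add_cancel_left [simp]:
  assumes "x \<in> carrier B" "y \<in> carrier B"
  shows "x \<oplus> (\<ominus> x \<oplus> y) = y" "\<ominus> x \<oplus> (x \<oplus> y) = y"
  using assms by (simp_all add: add.m_assoc[symmetric])

declare brace_lambda_closed [simp]

lemma brace_lambda_zero [simp]: "a \<in> carrier B \<Longrightarrow> brace_lambda B a \<zero> = \<zero>"
  using r_one[of a] unfolding brace_lambda_def one_eq_zero by simp

lemma brace_lambda_minus:
  assumes "a \<in> carrier B" "b \<in> carrier B"
  shows "brace_lambda B a (\<ominus> b) = \<ominus> brace_lambda B a b"
proof (rule add.inv_equality[symmetric])
  show "brace_lambda B a (\<ominus> b) \<oplus> brace_lambda B a b = \<zero>"
    using assms by (simp flip: brace_lambda_add)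
qed (use assms in auto)

lemma mult_eq_add_brace_lambda:
  "\<lbrakk>a \<in> carrier B; b \<in> carrier B\<rbrakk> \<Longrightarrow> a \<otimes> b = a \<oplus> brace_lambda B a b"
  by (simp add: brace_lambda_def)

lemma brace_lambda_mult:
  assumes "a \<in> carrier B" "b \<in> carrier B" "c \<in> carrier B"
  shows "brace_lambda B (a \<otimes> b) c = brace_lambda B a (brace_lambda B b c)"
proof -
  have "brace_lambda B a (brace_lambda B b c) = brace_lambda B a (\<ominus> b \<oplus> (b \<otimes> c))"
    by (simp add: brace_lambda_def[of B b])
  also have "\<dots> = \<ominus> brace_lambda B a b \<oplus> brace_lambda B a (b \<otimes> c)"
    using assms by (simp add: brace_lambda_add brace_lambda_minus)
  also have "\<dots> = brace_lambda B (a \<otimes> b) c"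
    using assms by (simp add: brace_lambda_def add.inv_mult_group add.m_assoc m_assoc)
  finally show ?thesis by simp
qed

lemma brace_lambda_inv_cancel [simp]:
  assumes "a \<in> carrier B" "b \<in> carrier B"
  shows "brace_lambda B a (brace_lambda B (inv a) b) = b"
    and "brace_lambda B (inv a) (brace_lambda B a b) = b"
  using assms by (simp_all flip: brace_lambda_mult add: brace_lambda_def[of B \<one>])
     (simp_all add: one_eq_zero)

definition brace_star :: "'a \<Rightarrow> 'a \<Rightarrow> 'a" (infixl \<open>\<star>\<close> 70) where
  "a \<star> b = brace_lambda B a b \<oplus> \<ominus> b"

lemma brace_star_closed [simp]: "\<lbrakk>a \<in> carrier B; b \<in> carrier B\<rbrakk> \<Longrightarrow> a \<star> b \<in> carrier B"
  by (simp add: brace_star_def)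

lemma brace_lambda_eq_star:
  "\<lbrakk>a \<in> carrier B; b \<in> carrier B\<rbrakk> \<Longrightarrow> brace_lambda B a b = a \<star> b \<oplus> b"
  by (simp add: brace_star_def add.m_assoc)

lemma brace_star_add:
  assumes "a \<in> carrier B" "b \<in> carrier B" "c \<in> carrier B"
  shows "a \<star> (b \<oplus> c) = a \<star> b \<oplus> (b \<oplus> a \<star> c \<oplus> \<ominus> b)"
  using assms by (simp add: brace_star_def brace_lambda_add add.inv_mult_group add.m_assoc)

text \<open>Larger arguments give more generators, so fewer ideals contain them and the intersection
  grows.\<close>

lemma brace_commutator_mono:
  assumes "I \<subseteq> I'" "J \<subseteq> J'"
  shows "brace_commutator B I J \<subseteq> brace_commutator B I' J'"
proof -
  have "commutator_subgroup G I J \<subseteq> commutator_subgroup G I' J'"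
    if "group G" for G :: "('a, 'c) monoid_scheme"
    unfolding commutator_subgroup_def using assms by (intro group.mono_generate[OF that]) blast
  from this[OF add_group] this[OF is_group]
  have "commutator_subgroup (add_monoid B) I J \<subseteq> commutator_subgroup (add_monoid B) I' J'"
    "commutator_subgroup B I J \<subseteq> commutator_subgroup B I' J'" .
  then show ?thesis
    unfolding brace_commutator_def brace_ideal_generated_def using assms
    by (intro Inter_anti_mono Collect_mono) blast
qed

lemma zero_in_brace_derived_series: "\<zero> \<in> brace_derived_series B n"
proof (cases n)
  case (Suc m)
  have "\<zero> \<in> I" if "brace_ideal B I" for I
    using that subgroup.one_closed[of I "add_monoid B"]
    by (simp add: brace_ideal_def brace_left_ideal_def)
  then show ?thesis
    unfolding Suc brace_derived_series.simps brace_commutator_def brace_ideal_generated_def by blast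
qed simp

section \<open>Subgroups generated by stars, and left ideals\<close>

definition star_subgroup :: "'a set \<Rightarrow> 'a set" where
  "star_subgroup I = generate (add_monoid B) {i \<star> j | i j. i \<in> I \<and> j \<in> I}"

lemma subgroup_star_subgroup:
  "I \<subseteq> carrier B \<Longrightarrow> subgroup (star_subgroup I) (add_monoid B)"
  unfolding star_subgroup_def by (rule add.generate_is_subgroup) (auto simp: subset_iff)

lemma star_in_star_subgroup: "\<lbrakk>i \<in> I; j \<in> I\<rbrakk> \<Longrightarrow> i \<star> j \<in> star_subgroup I"
  unfolding star_subgroup_def by (rule generate.incl) auto

lemma add_subgroupD:
  assumes "subgroup H (add_monoid B)"
  shows "H \<subseteq> carrier B" "\<zero> \<in> H" "x \<in> H \<Longrightarrow> y \<in> H \<Longrightarrow> x \<oplus> y \<in> H" "x \<in> H \<Longrightarrow> \<ominus> x \<in> H"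
  using subgroup.subset[OF assms] subgroup.one_closed[OF assms] subgroup.m_closed[OF assms]
    subgroup.m_inv_closed[OF assms] by (simp_all add: a_inv_def)

text \<open>Products are \<open>a \<oplus> brace_lambda B a b\<close>; applied to
  \<open>inv a \<otimes> a\<close>, the same formula shows \<open>inv a\<close> to be the negative
  of an element of \<open>I\<close>.\<close>

lemma subgroup_if_brace_left_ideal:
  assumes "brace_left_ideal B I"
  shows "subgroup I B"
proof -
  have I: "subgroup I (add_monoid B)" and
    lam: "\<And>b x. b \<in> carrier B \<Longrightarrow> x \<in> I \<Longrightarrow> brace_lambda B b x \<in> I"
    using assms by (auto simp: brace_left_ideal_def)
  note IS = add_subgroupD[OF I]
  show ?thesis
  proof (rule subgroupI)
    fix a assume a: "a \<in> I"
    then have ac: "a \<in> carrier B" using IS by auto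
    have "inv a \<oplus> brace_lambda B (inv a) a = \<zero>"
      using ac by (simp flip: mult_eq_add_brace_lambda add: one_eq_zero)
    then have "inv a = \<ominus> brace_lambda B (inv a) a"
      using ac by (metis add.inv_equality add.inv_inv add.inv_closed brace_lambda_closed inv_closed)
    then show "inv a \<in> I" using IS lam a ac by (metis inv_closed)
  next
    fix a b assume "a \<in> I" "b \<in> I"
    then show "a \<otimes> b \<in> I"
      using IS lam by (metis mult_eq_add_brace_lambda subsetD)
  qed (use IS in auto)
qed

end

section \<open>Commutative multiplication and a criterion for ideals\<close>

context comm_skew_brace
begin

lemma brace_lambda_commute:
  assumes "a \<in> carrier B" "b \<in> carrier B" "c \<in> carrier B"
  shows "brace_lambda B a (brace_lambda B b c) = brace_lambda B b (brace_lambda B a c)"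
  using assms by (metis brace_lambda_mult m_comm)

text \<open>The two sides are \<open>a \<otimes> b\<close> and \<open>b \<otimes> a\<close>. In this
  form commutativity enters the additive computations.\<close>

lemma add_brace_lambda_commute:
  assumes "a \<in> carrier B" "b \<in> carrier B"
  shows "a \<oplus> brace_lambda B a b = b \<oplus> brace_lambda B b a"
  using assms by (metis mult_eq_add_brace_lambda m_comm)

lemma brace_lambda_star:
  assumes "a \<in> carrier B" "b \<in> carrier B" "c \<in> carrier B"
  shows "brace_lambda B b (a \<star> c) = a \<star> brace_lambda B b c"
  using assms
  by (simp add: brace_star_def brace_lambda_add brace_lambda_minus brace_lambda_commute)

text \<open>Inclusion under each \<lambda> suffices since \<open>inv b\<close> yields the inverse
  map; normality in the abelian multiplicative group is automatic.\<close>

lemma brace_idealI: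
  assumes sub: "subgroup I (add_monoid B)"
    and conj: "\<And>b x. \<lbrakk>b \<in> carrier B; x \<in> I\<rbrakk> \<Longrightarrow> b \<oplus> x \<oplus> \<ominus> b \<in> I"
    and lam: "\<And>b x. \<lbrakk>b \<in> carrier B; x \<in> I\<rbrakk> \<Longrightarrow> brace_lambda B b x \<in> I"
  shows "brace_ideal B I"
proof -
  have "brace_lambda B b ` I = I" if b: "b \<in> carrier B" for b
  proof
    show "I \<subseteq> brace_lambda B b ` I"
    proof
      fix x assume x: "x \<in> I"
      then have "x = brace_lambda B b (brace_lambda B (inv b) x)"
        using b add_subgroupD(1)[OF sub] by auto
      then show "x \<in> brace_lambda B b ` I" using lam[of "inv b" x] b x by blast
    qed
  qed (use lam b in auto)
  then have left: "brace_left_ideal B I"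
    using sub by (simp add: brace_left_ideal_def)
  moreover have "I \<lhd> add_monoid B"
    using sub conj by (auto simp: add.normal_inv_iff)
  moreover have "I \<lhd> B"
    using subgroup_imp_normal subgroup_if_brace_left_ideal[OF left] by auto
  ultimately show ?thesis by (simp add: brace_ideal_def)
qed

lemma brace_idealD:
  assumes "brace_ideal B I"
  shows "subgroup I (add_monoid B)"
    and "\<lbrakk>b \<in> carrier B; x \<in> I\<rbrakk> \<Longrightarrow> b \<oplus> x \<oplus> \<ominus> b \<in> I"
    and "\<lbrakk>b \<in> carrier B; x \<in> I\<rbrakk> \<Longrightarrow> brace_lambda B b x \<in> I"
  using assms by (auto simp: brace_ideal_def brace_left_ideal_def add.normal_inv_iff)

text \<open>The image of a generated subgroup is generated by the images of the generators. Serves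
  for conjugations and for the maps \<open>brace_lambda B b\<close>.\<close>

lemma star_subgroup_hom_closed:
  assumes I: "I \<subseteq> carrier B"
    and f: "f \<in> hom (add_monoid B) (add_monoid B)"
    and gen: "\<And>i j. \<lbrakk>i \<in> I; j \<in> I\<rbrakk> \<Longrightarrow> f (i \<star> j) \<in> star_subgroup I"
    and d: "d \<in> star_subgroup I"
  shows "f d \<in> star_subgroup I"
proof -
  let ?S = "{i \<star> j | i j. i \<in> I \<and> j \<in> I}"
  interpret f: group_hom "add_monoid B" "add_monoid B" f
    using f add_group by (simp add: group_hom_def group_hom_axioms_def)
  have "f ` star_subgroup I = generate (add_monoid B) (f ` ?S)"
    unfolding star_subgroup_def using I
    by (intro f.generate_img[symmetric]) (auto simp: subset_iff)
  also have "\<dots> \<subseteq> star_subgroup I"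
    using gen I by (intro add.generate_subgroup_incl subgroup_star_subgroup) auto
  finally show ?thesis using d by blast
qed

lemma conj_in_hom:
  "b \<in> carrier B \<Longrightarrow> (\<lambda>x. b \<oplus> x \<oplus> \<ominus> b) \<in> hom (add_monoid B) (add_monoid B)"
  by (auto simp: hom_def add.m_assoc)

lemma brace_lambda_in_hom:
  "b \<in> carrier B \<Longrightarrow> brace_lambda B b \<in> hom (add_monoid B) (add_monoid B)"
  by (auto simp: hom_def brace_lambda_add)

lemma conj_star:
  assumes "a \<in> carrier B" "b \<in> carrier B" "c \<in> carrier B"
  shows "b \<oplus> a \<star> c \<oplus> \<ominus> b = \<ominus> (a \<star> b) \<oplus> a \<star> (b \<oplus> c)"
  using assms by (simp add: brace_star_add)

section \<open>For an ideal, the star subgroup is an ideal containing the commutator\<close>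

context
  fixes I
  assumes ideal: "brace_ideal B I"
begin

private lemmas IS = add_subgroupD[OF brace_idealD(1)[OF ideal]]
private lemmas DS = add_subgroupD[OF subgroup_star_subgroup[OF IS(1)]]

private lemma Icarr [simp]: "x \<in> I \<Longrightarrow> x \<in> carrier B"
  using IS(1) by auto

private lemma Dcarr [simp]: "x \<in> star_subgroup I \<Longrightarrow> x \<in> carrier B"
  using DS(1) by auto

text \<open>Exchanging \<open>i\<close> and \<open>b\<close> in the product turns \<lambda> with
  subscript \<open>i\<close> into \<lambda> with subscript \<open>b\<close> applied to
  \<open>i\<close>, which stays in \<open>I\<close>.\<close>

lemma star_in_ideal:
  assumes "i \<in> I" "b \<in> carrier B"
  shows "i \<star> b \<in> I"
proof -
  have "i \<star> b = \<ominus> i \<oplus> (i \<oplus> brace_lambda B i b) \<oplus> \<ominus> b"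
    using assms by (simp add: brace_star_def)
  also have "\<dots> = \<ominus> i \<oplus> (b \<oplus> brace_lambda B b i \<oplus> \<ominus> b)"
    using assms by (simp only: add_brace_lambda_commute Icarr) (simp add: add.m_assoc)
  also have "\<dots> \<in> I"
    using assms IS(3,4) brace_idealD(2,3)[OF ideal] by auto
  finally show ?thesis .
qed

lemma star_subgroup_subset: "star_subgroup I \<subseteq> I"
  unfolding star_subgroup_def
  using star_in_ideal brace_idealD(1)[OF ideal] by (intro add.generate_subgroup_incl) auto

text \<open>For \<open>c\<close> in \<open>I\<close>, \<open>conj_star\<close> writes the conjugate
  of a generator through two further generators. This fails for general \<open>c\<close>, where
  \<open>i \<star> c\<close> is only known to lie in \<open>I\<close>.\<close>

private lemma conj_closed_inner:
  assumes "c \<in> I" "d \<in> star_subgroup I"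
  shows "c \<oplus> d \<oplus> \<ominus> c \<in> star_subgroup I"
proof (rule star_subgroup_hom_closed[OF IS(1) conj_in_hom _ assms(2)])
  fix i j assume "i \<in> I" "j \<in> I"
  then show "c \<oplus> i \<star> j \<oplus> \<ominus> c \<in> star_subgroup I"
    using assms(1) IS(3) DS(3,4) by (simp add: conj_star star_in_star_subgroup)
qed (use assms in auto)

text \<open>Each of the equal products \<open>i \<otimes> j\<close> and \<open>j \<otimes> i\<close>
  is the corresponding sum up to a conjugated star on the left.\<close>

lemma commutator_in_star_subgroup:
  assumes "i \<in> I" "j \<in> I"
  shows "i \<oplus> j \<oplus> \<ominus> i \<oplus> \<ominus> j \<in> star_subgroup I"
proof -
  have shift: "i \<oplus> brace_lambda B i j = (i \<oplus> i \<star> j \<oplus> \<ominus> i) \<oplus> (i \<oplus> j)"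
    if "i \<in> I" "j \<in> I" for i j
    using that by (simp add: brace_lambda_eq_star add.m_assoc)
  define u where "u = i \<oplus> i \<star> j \<oplus> \<ominus> i"
  define v where "v = j \<oplus> j \<star> i \<oplus> \<ominus> j"
  have uv: "u \<in> star_subgroup I" "v \<in> star_subgroup I"
    using assms conj_closed_inner star_in_star_subgroup by (auto simp: u_def v_def)
  have "u \<oplus> (i \<oplus> j) = v \<oplus> (j \<oplus> i)"
    using shift assms add_brace_lambda_commute[of i j] by (simp add: u_def v_def)
  then have "i \<oplus> j = \<ominus> u \<oplus> (v \<oplus> (j \<oplus> i))"
    using assms uv by (metis Dcarr Icarr add.m_closed add_cancel_left(2))
  then have "i \<oplus> j \<oplus> \<ominus> i \<oplus> \<ominus> j = \<ominus> u \<oplus> v"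
    using assms uv by (simp add: add.m_assoc)
  then show ?thesis using uv DS(3,4) by simp
qed

lemma brace_ideal_star_subgroup: "brace_ideal B (star_subgroup I)"
proof (rule brace_idealI)
  show "subgroup (star_subgroup I) (add_monoid B)"
    by (rule subgroup_star_subgroup[OF IS(1)])
next
  fix b d assume b: "b \<in> carrier B" and d: "d \<in> star_subgroup I"
  show "b \<oplus> d \<oplus> \<ominus> b \<in> star_subgroup I"
  proof (rule star_subgroup_hom_closed[OF IS(1) conj_in_hom _ d])
    fix i j assume ij: "i \<in> I" "j \<in> I"
    \<comment> \<open>Moving \<open>b\<close> to the right of \<open>k\<close> makes
      \<open>u = i \<star> b\<close> occur with both signs. What remains is a conjugate of
      \<open>i \<star> k\<close> by an element of \<open>I\<close> and a commutator of elements of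
      \<open>I\<close>.\<close>
    define k where "k = b \<oplus> j \<oplus> \<ominus> b"
    define u where "u = i \<star> b"
    have mem: "k \<in> I" "u \<in> I"
      using ij b brace_idealD(2)[OF ideal] star_in_ideal by (auto simp: k_def u_def)
    have bj: "b \<oplus> j = k \<oplus> b"
      using ij b by (simp add: k_def add.m_assoc)
    have "b \<oplus> i \<star> j \<oplus> \<ominus> b = \<ominus> u \<oplus> i \<star> (k \<oplus> b)"
      using ij b by (simp add: conj_star u_def bj)
    also have "\<dots> = \<ominus> u \<oplus> (i \<star> k \<oplus> (k \<oplus> u \<oplus> \<ominus> k))"
      using ij b mem by (simp add: brace_star_add u_def)
    also have "\<dots> = (\<ominus> u \<oplus> i \<star> k \<oplus> \<ominus> (\<ominus> u)) \<oplus> (\<ominus> u \<oplus> k \<oplus> \<ominus> (\<ominus> u) \<oplus> \<ominus> k)"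
      using ij b mem by (simp add: add.m_assoc)
    also have "\<dots> \<in> star_subgroup I"
      using mem ij
      by (intro DS(3) conj_closed_inner commutator_in_star_subgroup star_in_star_subgroup IS(4))
    finally show "b \<oplus> i \<star> j \<oplus> \<ominus> b \<in> star_subgroup I" .
  qed (use b in auto)
  show "brace_lambda B b d \<in> star_subgroup I"
  proof (rule star_subgroup_hom_closed[OF IS(1) brace_lambda_in_hom _ d])
    fix i j assume "i \<in> I" "j \<in> I"
    then show "brace_lambda B b (i \<star> j) \<in> star_subgroup I"
      using b brace_idealD(3)[OF ideal] by (simp add: brace_lambda_star star_in_star_subgroup)
  qed (use b in auto)
qed

lemma brace_commutator_self_subset: "brace_commutator B I I \<subseteq> star_subgroup I"
proof -
  have "commutator_subgroup (add_monoid B) I I \<subseteq> star_subgroup I"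
    unfolding commutator_subgroup_def
    using commutator_in_star_subgroup
    by (intro add.generate_subgroup_incl subgroup_star_subgroup IS(1)) (auto simp: a_inv_def)
  moreover have "commutator_subgroup B I I \<subseteq> star_subgroup I"
  proof -
    have "i \<otimes> j \<otimes> inv i \<otimes> inv j = \<zero>" if "i \<in> I" "j \<in> I" for i j
      using that m_comm[of i j] by (simp add: m_assoc one_eq_zero[symmetric])
    then show ?thesis
      unfolding commutator_subgroup_def
      using DS(2) subgroup_if_brace_left_ideal brace_ideal_star_subgroup
      by (intro generate_subgroup_incl) (auto simp: brace_ideal_def)
  qed
  moreover have "(i \<otimes> j) \<ominus> (i \<oplus> j) \<in> star_subgroup I" if "i \<in> I" "j \<in> I" for i j
  proof -
    have "(i \<otimes> j) \<ominus> (i \<oplus> j) = i \<oplus> i \<star> j \<oplus> \<ominus> i"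
      using that by (simp add: mult_eq_add_brace_lambda a_minus_def brace_star_def
          add.inv_mult_group add.m_assoc)
    then show ?thesis using that conj_closed_inner star_in_star_subgroup by simp
  qed
  ultimately show ?thesis
    unfolding brace_commutator_def brace_ideal_generated_def
    using brace_ideal_star_subgroup by (intro Inter_lower) auto
qed

end

section \<open>Ito's argument: stars commute additively\<close>

text \<open>
  Put \<open>t\<^sub>c = (0, \<lambda>\<^sub>c)\<close> in the semidirect product. Then \<open>a - \<lambda>\<^sub>c(a)\<close> is the commutator of
  \<open>(a, \<lambda>\<^sub>a)\<close> and \<open>t\<^sub>c\<close>, and \<open>h\<close> (the subscript of \<open>\<lambda>\<close> on the right) comes from factoring the
  conjugate of \<open>t\<^sub>c\<close> by \<open>(b, \<lambda>\<^sub>b)\<close> as \<open>t\<^sub>h\<close> times some \<open>(g, \<lambda>\<^sub>g)\<close>. Since \<open>h\<close> does not depend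
  on \<open>a\<close>, conjugations by \<open>(b, \<lambda>\<^sub>b)\<close> and by \<open>t\<^sub>d\<close> commute on these elements.
\<close>
lemma conj_lambda_diff:
  assumes [simp]: "a \<in> carrier B" "b \<in> carrier B" "c \<in> carrier B"
  shows "b \<oplus> brace_lambda B b (a \<oplus> \<ominus> brace_lambda B c a) \<oplus> \<ominus> b
    = a \<oplus> \<ominus> brace_lambda B (c \<otimes> (b \<oplus> \<ominus> brace_lambda B (inv c) b)) a"
proof -
  let ?l = "brace_lambda B"
  define g where "g = b \<oplus> \<ominus> ?l (inv c) b"
  define w where "w = b \<oplus> \<ominus> ?l c b"
  have [simp]: "g \<in> carrier B" "w \<in> carrier B"
    by (simp_all add: g_def w_def)
  have cg: "?l c g = \<ominus> w"
    by (simp add: g_def w_def brace_lambda_add brace_lambda_minus add.inv_mult_group)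
  have "?l (c \<otimes> g) a = ?l c (\<ominus> g \<oplus> (g \<oplus> ?l g a))"
    by (simp add: brace_lambda_mult)
  \<comment> \<open>The exchange removes \<open>g\<close> from the subscript of \<lambda>.\<close>
  also have "\<dots> = ?l c (\<ominus> g \<oplus> (a \<oplus> ?l a g))"
    by (simp only: add_brace_lambda_commute[of g a] assms \<open>g \<in> carrier B\<close>)
  also have "\<dots> = w \<oplus> ?l c a \<oplus> \<ominus> ?l a w"
    by (simp add: brace_lambda_add brace_lambda_minus brace_lambda_commute[of c a] cg add.m_assoc)
  finally have "a \<oplus> \<ominus> ?l (c \<otimes> g) a = (a \<oplus> ?l a b) \<oplus> \<ominus> ?l c (a \<oplus> ?l a b) \<oplus> ?l c b \<oplus> \<ominus> b"
    by (simp add: w_def brace_lambda_add brace_lambda_minus brace_lambda_commute[of c a]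
        add.inv_mult_group add.m_assoc)
  \<comment> \<open>The expression depends on \<open>a\<close> essentially through
    \<open>a \<otimes> b\<close>, so the factors can be swapped.\<close>
  also have "\<dots> = (b \<oplus> ?l b a) \<oplus> \<ominus> ?l c (b \<oplus> ?l b a) \<oplus> ?l c b \<oplus> \<ominus> b"
    by (simp only: add_brace_lambda_commute[of a b] assms)
  also have "\<dots> = b \<oplus> ?l b (a \<oplus> \<ominus> ?l c a) \<oplus> \<ominus> b"
    by (simp add: brace_lambda_add brace_lambda_minus brace_lambda_commute[of c b]
        add.inv_mult_group add.m_assoc)
  finally show ?thesis by (simp add: g_def)
qed

text \<open>Conjugating the difference in \<open>a\<close> and \<open>c\<close> by \<open>b\<close>
  and by \<open>brace_lambda B d b\<close> gives the same result, so the quotient of these two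
  conjugators centralizes it.\<close>

lemma lambda_diff_commute:
  assumes a[simp]: "a \<in> carrier B" and b[simp]: "b \<in> carrier B"
    and c[simp]: "c \<in> carrier B" and d[simp]: "d \<in> carrier B"
  shows "(\<ominus> brace_lambda B d b \<oplus> b) \<oplus> (a \<oplus> \<ominus> brace_lambda B c a)
    = (a \<oplus> \<ominus> brace_lambda B c a) \<oplus> (\<ominus> brace_lambda B d b \<oplus> b)"
proof -
  let ?l = "brace_lambda B"
  \<comment> \<open>Undoing both maps lets \<open>conj_lambda_diff\<close> be used at
    \<open>brace_lambda B d a'\<close> and at \<open>a'\<close>, with the same
    \<open>h\<close>.\<close>
  define a' where "a' = ?l (inv b) (?l (inv d) a)"
  have [simp]: "a' \<in> carrier B" by (simp add: a'_def)
  have a': "a = ?l d (?l b a')" by (simp add: a'_def brace_lambda_commute[of d b])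
  define h where "h = c \<otimes> (b \<oplus> \<ominus> ?l (inv c) b)"
  have [simp]: "h \<in> carrier B" by (simp add: h_def)
  define z where "z = a \<oplus> \<ominus> ?l c a"
  have [simp]: "z \<in> carrier B" by (simp add: z_def)
  have z: "z = ?l b (?l d a' \<oplus> \<ominus> ?l c (?l d a'))"
    by (simp add: z_def a' brace_lambda_add brace_lambda_minus brace_lambda_commute)
  have z': "z = ?l d (?l b (a' \<oplus> \<ominus> ?l c a'))"
    by (simp add: z_def a' brace_lambda_add brace_lambda_minus brace_lambda_commute)
  have "b \<oplus> z \<oplus> \<ominus> b = ?l d a' \<oplus> \<ominus> ?l h (?l d a')"
    unfolding z h_def by (rule conj_lambda_diff) auto
  also have "\<dots> = ?l d (a' \<oplus> \<ominus> ?l h a')"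
    by (simp add: brace_lambda_add brace_lambda_minus brace_lambda_commute[of h d])
  also have "a' \<oplus> \<ominus> ?l h a' = b \<oplus> ?l b (a' \<oplus> \<ominus> ?l c a') \<oplus> \<ominus> b"
    unfolding h_def by (rule conj_lambda_diff[symmetric]) auto
  also have "?l d \<dots> = ?l d b \<oplus> z \<oplus> \<ominus> ?l d b"
    unfolding z' by (simp add: brace_lambda_add brace_lambda_minus)
  finally have "\<ominus> ?l d b \<oplus> (b \<oplus> z \<oplus> \<ominus> b) \<oplus> b
      = \<ominus> ?l d b \<oplus> (?l d b \<oplus> z \<oplus> \<ominus> ?l d b) \<oplus> b"
    by simp
  then show ?thesis
    unfolding z_def[symmetric] by (simp add: add.m_assoc)
qed

lemma star_commute:
  assumes [simp]: "a \<in> carrier B" "b \<in> carrier B" "c \<in> carrier B" "d \<in> carrier B"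
  shows "a \<star> b \<oplus> c \<star> d = c \<star> d \<oplus> a \<star> b"
  \<comment> \<open>With these arguments the two differences become \<open>a \<star> b\<close> and
    \<open>c \<star> d\<close>.\<close>
  using lambda_diff_commute[of "brace_lambda B c d" "\<ominus> b" "inv c" a]
  by (simp add: brace_star_def brace_lambda_minus)

section \<open>Skew braces generated by their stars\<close>

lemma add_subgroup_centralizer:
  assumes "S \<subseteq> carrier B"
  shows "subgroup {x \<in> carrier B. \<forall>s \<in> S. x \<oplus> s = s \<oplus> x} (add_monoid B)" (is "subgroup ?H _")
proof (rule add.subgroupI)
  show "?H \<noteq> {}" using assms by (auto intro!: exI[of _ \<zero>])
next
  fix x assume "x \<in> ?H"
  moreover have "\<ominus> x \<oplus> s = s \<oplus> \<ominus> x" if "s \<in> S" "x \<in> ?H" for s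
  proof -
    have s: "s \<in> carrier B" "x \<in> carrier B" and xs: "x \<oplus> s = s \<oplus> x" using that assms by auto
    have "\<ominus> x \<oplus> s = \<ominus> x \<oplus> (s \<oplus> x) \<oplus> \<ominus> x" using s by (simp add: add.m_assoc)
    also have "\<dots> = s \<oplus> \<ominus> x" using s by (simp flip: xs)
    finally show ?thesis .
  qed
  ultimately show "\<ominus> x \<in> ?H" by auto
next
  fix x y assume xy: "x \<in> ?H" "y \<in> ?H"
  have "x \<oplus> y \<oplus> s = s \<oplus> (x \<oplus> y)" if "s \<in> S" for s
    using that xy assms by (simp add: subset_iff) (metis add.m_assoc)
  then show "x \<oplus> y \<in> ?H" using xy by auto
qed auto

text \<open>\<open>gen\<close> is used twice: centralizers of single stars are everything, so stars
  are central; then the centralizer of any \<open>x\<close> contains all stars.\<close>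

lemma add_commute_if_star_generated:
  assumes gen: "\<And>H. \<lbrakk>subgroup H (add_monoid B);
      \<And>a b. \<lbrakk>a \<in> carrier B; b \<in> carrier B\<rbrakk> \<Longrightarrow> a \<star> b \<in> H\<rbrakk> \<Longrightarrow> H = carrier B"
    and xy: "x \<in> carrier B" "y \<in> carrier B"
  shows "x \<oplus> y = y \<oplus> x"
proof -
  have central: "x \<oplus> a \<star> b = a \<star> b \<oplus> x"
    if "a \<in> carrier B" "b \<in> carrier B" "x \<in> carrier B" for a b x
    using gen[OF add_subgroup_centralizer[of "{a \<star> b}"]] star_commute that by auto
  have "{z \<in> carrier B. \<forall>s \<in> {x}. z \<oplus> s = s \<oplus> z} = carrier B"
    using central xy by (intro gen add_subgroup_centralizer) auto
  then have "y \<in> {z \<in> carrier B. \<forall>s \<in> {x}. z \<oplus> s = s \<oplus> z}"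
    using xy by simp
  then show ?thesis by simp
qed

lemma trivial_if_star_generated:
  assumes fin: "finite (carrier B)"
    and gen: "\<And>H. \<lbrakk>subgroup H (add_monoid B);
      \<And>a b. \<lbrakk>a \<in> carrier B; b \<in> carrier B\<rbrakk> \<Longrightarrow> a \<star> b \<in> H\<rbrakk> \<Longrightarrow> H = carrier B"
  shows "carrier B = {\<zero>}"
proof (rule ccontr)
  assume nontriv: "carrier B \<noteq> {\<zero>}"
  have add_commute: "x \<oplus> y = y \<oplus> x" if "x \<in> carrier B" "y \<in> carrier B" for x y
    using add_commute_if_star_generated[OF gen] that by blast
  have add_left_commute: "x \<oplus> (y \<oplus> z) = y \<oplus> (x \<oplus> z)"
    if "x \<in> carrier B" "y \<in> carrier B" "z \<in> carrier B" for x y z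
    using that by (metis add.m_assoc add_commute)
  note ac = add.m_assoc add_commute add_left_commute
  have star_commutative: "x \<star> y = y \<star> x" if "x \<in> carrier B" "y \<in> carrier B" for x y
    using that by (simp add: brace_star_def brace_lambda_def ac m_comm)
  have star_add_right: "x \<star> (y \<oplus> z) = x \<star> y \<oplus> x \<star> z"
    if "x \<in> carrier B" "y \<in> carrier B" "z \<in> carrier B" for x y z
    using that by (simp add: brace_star_add ac)
  have star_minus_left: "\<ominus> x \<star> y = \<ominus> (x \<star> y)"
    if "x \<in> carrier B" "y \<in> carrier B" for x y
    using that by (simp add: star_commutative[of _ y])
      (simp add: brace_star_def brace_lambda_minus add.inv_mult_group add_commute)
  have star_left_commute: "x \<star> (y \<star> z) = y \<star> (x \<star> z)"
    if "x \<in> carrier B" "y \<in> carrier B" "z \<in> carrier B" for x y z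
    using that
    by (simp add: brace_star_def brace_lambda_add brace_lambda_minus add.inv_mult_group
        brace_lambda_commute ac)
  \<comment> \<open>These are the proper ideals of the radical ring with product
    \<open>\<star>\<close>.\<close>
  define F where "F = {K. subgroup K (add_monoid B) \<and> K \<noteq> carrier B \<and>
    (\<forall>b \<in> carrier B. \<forall>x \<in> K. b \<star> x \<in> K)}"
  have "subgroup {\<zero>} (add_monoid B)"
    using add.triv_subgroup by simp
  then have "{\<zero>} \<in> F"
    using nontriv by (auto simp: F_def brace_star_def)
  moreover have "finite F"
    using fin by (rule finite_subset[rotated, OF finite_Pow_iff[THEN iffD2]])
      (auto simp: F_def dest: add_subgroupD(1))
  ultimately obtain K where K: "K \<in> F" and max: "\<And>L. L \<in> F \<Longrightarrow> K \<subseteq> L \<Longrightarrow> K = L"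
    using finite_has_maximal[of F] by auto
  have subK: "subgroup K (add_monoid B)" and "K \<noteq> carrier B"
    and Kstar: "\<And>b x. b \<in> carrier B \<Longrightarrow> x \<in> K \<Longrightarrow> b \<star> x \<in> K"
    using K by (auto simp: F_def)
  note KS = add_subgroupD[OF subK]
  have Kc [simp]: "x \<in> carrier B" if "x \<in> K" for x using KS(1) that by auto
  obtain a b where ab: "a \<in> carrier B" "b \<in> carrier B" "a \<star> b \<notin> K"
    using gen[OF subK] \<open>K \<noteq> carrier B\<close> by blast
  \<comment> \<open>The ideal generated by \<open>K\<close> and the multiples of \<open>a\<close>.
    It contains \<open>a \<star> b\<close>, which is outside \<open>K\<close>, so maximality makes
    it everything.\<close>
  define L where "L = {a \<star> z \<oplus> k | z k. z \<in> carrier B \<and> k \<in> K}"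
  have LI: "a \<star> z \<oplus> k \<in> L" if "z \<in> carrier B" "k \<in> K" for z k
    using that unfolding L_def by blast
  have "subgroup L (add_monoid B)"
  proof (rule add.subgroupI)
    show "L \<subseteq> carrier B" using ab by (auto simp: L_def)
    show "L \<noteq> {}" using LI[of \<zero> \<zero>] KS(2) by auto
  next
    fix x assume "x \<in> L"
    then obtain z k where zk: "z \<in> carrier B" "k \<in> K" "x = a \<star> z \<oplus> k" by (auto simp: L_def)
    then have "\<ominus> x = a \<star> (\<ominus> z) \<oplus> \<ominus> k"
      using ab by (simp add: brace_star_def brace_lambda_minus add.inv_mult_group ac)
    then show "\<ominus> x \<in> L" using LI[of "\<ominus> z" "\<ominus> k"] zk KS(4) by simp
  next
    fix x y assume "x \<in> L" "y \<in> L"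
    then obtain z k z' k' where zk: "z \<in> carrier B" "k \<in> K" "x = a \<star> z \<oplus> k"
      "z' \<in> carrier B" "k' \<in> K" "y = a \<star> z' \<oplus> k'" by (auto simp: L_def)
    then have "x \<oplus> y = a \<star> (z \<oplus> z') \<oplus> (k \<oplus> k')"
      using ab by (simp add: star_add_right ac)
    then show "x \<oplus> y \<in> L" using LI[of "z \<oplus> z'" "k \<oplus> k'"] zk KS(3) by simp
  qed
  moreover have "c \<star> x \<in> L" if "c \<in> carrier B" "x \<in> L" for c x
  proof -
    obtain z k where zk: "z \<in> carrier B" "k \<in> K" "x = a \<star> z \<oplus> k"
      using \<open>x \<in> L\<close> by (auto simp: L_def)
    then have "c \<star> x = a \<star> (c \<star> z) \<oplus> c \<star> k"
      using ab \<open>c \<in> carrier B\<close> by (simp add: star_add_right star_left_commute[of c a])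
    then show ?thesis using LI[of "c \<star> z" "c \<star> k"] zk Kstar \<open>c \<in> carrier B\<close> by simp
  qed
  moreover have "K \<subseteq> L"
  proof
    fix k assume "k \<in> K"
    then show "k \<in> L" using LI[of \<zero> k] ab by (simp add: brace_star_def)
  qed
  moreover have "K \<noteq> L"
    using LI[of b \<zero>] KS(2) ab by auto
  ultimately have "L = carrier B"
    using max[of L] by (auto simp: F_def)
  then have "a \<in> L" using ab by simp
  then obtain e k where e: "e \<in> carrier B" "k \<in> K" "a = a \<star> e \<oplus> k"
    unfolding L_def by blast
  \<comment> \<open>\<open>e\<close> acts as a unit modulo \<open>K\<close>, so \<open>\<lambda>\<^bsub>-e\<^esub>\<close> vanishes modulo \<open>K\<close> although it is bijective.\<close>
  have unit: "\<ominus> (e \<star> y) \<oplus> y \<in> K" if y: "y \<in> carrier B" for y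
  proof -
    obtain z k' where z: "z \<in> carrier B" "k' \<in> K" "y = a \<star> z \<oplus> k'"
      using y \<open>L = carrier B\<close> unfolding L_def by blast
    have "a \<star> z = z \<star> (a \<star> e \<oplus> k)"
      using ab z e by (simp add: star_commutative)
    also have "\<dots> = z \<star> (a \<star> e) \<oplus> z \<star> k"
      using ab z e(1,2) by (simp add: star_add_right)
    also have "z \<star> (a \<star> e) = a \<star> (e \<star> z)"
      using ab z e(1,2) by (metis star_commutative star_left_commute)
    also have "\<dots> = e \<star> (a \<star> z)"
      using ab z e(1,2) by (metis star_left_commute)
    finally have "y = e \<star> (a \<star> z) \<oplus> z \<star> k \<oplus> k'"
      using z(3) by metis
    then have "y = e \<star> (a \<star> z) \<oplus> (z \<star> k \<oplus> k')"
      using ab z(1,2) e(1,2) by (simp add: add.m_assoc)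
    moreover have "e \<star> y = e \<star> (a \<star> z) \<oplus> e \<star> k'"
      using ab z e(1,2) by (simp add: star_add_right)
    moreover have "\<ominus> (p \<oplus> s) \<oplus> (p \<oplus> q) = q \<oplus> \<ominus> s"
      if "p \<in> carrier B" "q \<in> carrier B" "s \<in> carrier B" for p q s
      using that by (simp add: add.inv_mult_group add.m_assoc add_commute[of q])
    ultimately have "\<ominus> (e \<star> y) \<oplus> y = z \<star> k \<oplus> k' \<oplus> \<ominus> (e \<star> k')"
      using ab z(1,2) e(1,2) by (metis Kc add.m_closed brace_star_closed)
    then show ?thesis using z e KS(3,4) Kstar by simp
  qed
  have "y \<in> K" if y: "y \<in> carrier B" for y
  proof -
    define x where "x = brace_lambda B (inv (\<ominus> e)) y"
    have x: "x \<in> carrier B" using y e by (simp add: x_def)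
    have "y = brace_lambda B (\<ominus> e) x" using y e by (simp add: x_def)
    also have "\<dots> = \<ominus> (e \<star> x) \<oplus> x"
      using x e by (simp add: brace_lambda_eq_star star_minus_left)
    finally show ?thesis using unit x by simp
  qed
  then show False using \<open>K \<noteq> carrier B\<close> KS(1) by blast
qed

section \<open>Ideals as skew braces, and the descent\<close>

lemma a_inv_restrict:
  assumes "subgroup I (add_monoid B)" "x \<in> I"
  shows "\<ominus>\<^bsub>B\<lparr>carrier := I\<rparr>\<^esub> x = \<ominus> x"
  using group.m_inv_consistent[OF add_group assms] by (simp add: a_inv_def)

lemma comm_skew_brace_ideal:
  assumes "brace_ideal B I"
  shows "comm_skew_brace (B\<lparr>carrier := I\<rparr>)"
proof -
  let ?A = "B\<lparr>carrier := I\<rparr>"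
  note sub = brace_idealD(1)[OF assms]
  have subB: "subgroup I B"
    using assms by (auto simp: brace_ideal_def subgroup_if_brace_left_ideal)
  have carr: "x \<in> carrier B" if "x \<in> I" for x
    using that add_subgroupD(1)[OF sub] by auto
  have grp: "group ?A" using subB by (rule subgroup_imp_group)
  then have "comm_group ?A"
    by (rule group.group_comm_groupI) (auto simp: carr m_comm)
  moreover have "group (add_monoid ?A)"
    using group.subgroup_imp_group[OF add_group sub] by simp
  moreover have "a \<otimes> (b \<oplus> c) = ((a \<otimes> b) \<ominus>\<^bsub>?A\<^esub> a) \<oplus> (a \<otimes> c)" if "a \<in> I" "b \<in> I" "c \<in> I" for a b c
    using that carr by (simp add: a_minus_def a_inv_restrict[OF sub] brace_distrib)
  ultimately show ?thesis
    using grp by (simp add: comm_skew_brace_def skew_brace_def skew_brace_axioms_def)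
qed

text \<open>Stars computed in \<open>I\<close> and in \<open>B\<close> agree, so equality would make
  \<open>I\<close>, as a skew brace, generated by its stars and hence trivial.\<close>

lemma star_subgroup_psubset:
  assumes "brace_ideal B I" "finite I" "I \<noteq> {\<zero>}"
  shows "star_subgroup I \<subset> I"
proof -
  let ?A = "B\<lparr>carrier := I\<rparr>"
  note sub = brace_idealD(1)[OF assms(1)]
  interpret A: comm_skew_brace ?A using assms(1) by (rule comm_skew_brace_ideal)
  have star: "A.brace_star a b = a \<star> b" if "a \<in> I" "b \<in> I" for a b
    using that by (simp add: A.brace_star_def brace_star_def brace_lambda_def a_inv_restrict[OF sub])
  have False if eq: "star_subgroup I = I"
  proof -
    have "H = carrier ?A"
      if H: "subgroup H (add_monoid ?A)"
        and stars: "\<And>a b. \<lbrakk>a \<in> carrier ?A; b \<in> carrier ?A\<rbrakk> \<Longrightarrow> A.brace_star a b \<in> H" for H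
    proof
      have "subgroup H (add_monoid B)"
        using group.incl_subgroup[OF add_group sub] H by simp
      then have "star_subgroup I \<subseteq> H"
        unfolding star_subgroup_def
        using stars star by (intro add.generate_subgroup_incl) fastforce+
      then show "carrier ?A \<subseteq> H" using eq by simp
    qed (use subgroup.subset[OF H] in simp)
    then have "carrier ?A = {\<zero>\<^bsub>?A\<^esub>}"
      using assms(2) by (intro A.trivial_if_star_generated) auto
    then show False using assms(3) by simp
  qed
  then show ?thesis using star_subgroup_subset[OF assms(1)] by auto
qed

lemma iterated_star_subgroup_trivial:
  assumes "finite I" "brace_ideal B I"
  shows "\<exists>n. (star_subgroup ^^ n) I = {\<zero>}"
  using assms
proof (induction I rule: finite_psubset_induct)
  case (psubset I)
  show ?case
  proof (cases "I = {\<zero>}")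
    case True
    then show ?thesis by (intro exI[of _ 0]) simp
  next
    case False
    then have "star_subgroup I \<subset> I"
      using psubset star_subgroup_psubset by blast
    then obtain n where "(star_subgroup ^^ n) (star_subgroup I) = {\<zero>}"
      using psubset brace_ideal_star_subgroup by blast
    then have "(star_subgroup ^^ Suc n) I = {\<zero>}"
      by (simp add: funpow_swap1)
    then show ?thesis by blast
  qed
qed

lemma brace_ideal_iterated_star_subgroup: "brace_ideal B ((star_subgroup ^^ n) (carrier B))"
  by (induction n) (auto intro: brace_ideal_carrier brace_ideal_star_subgroup)

text \<open>Monotonicity of the commutator passes the bound to the next term, where the commutator
  of an ideal with itself lies in its star subgroup.\<close>

lemma brace_derived_series_subset:
  "brace_derived_series B n \<subseteq> (star_subgroup ^^ n) (carrier B)"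
proof (induction n)
  case (Suc n)
  have "brace_derived_series B (Suc n)
      \<subseteq> brace_commutator B ((star_subgroup ^^ n) (carrier B)) ((star_subgroup ^^ n) (carrier B))"
    using Suc by (simp add: brace_commutator_mono)
  then show ?case
    using brace_commutator_self_subset[OF brace_ideal_iterated_star_subgroup] by auto
qed simp

end

theorem corollary4p10:
  fixes B :: "('a, 'm) ring_scheme"
  assumes "skew_brace B"
    and "finite (carrier B)"
    and "comm_group B"
  shows "brace_solvable B"
proof -
  interpret comm_skew_brace B
    using assms by (simp add: comm_skew_brace_def)
  obtain n where n: "(star_subgroup ^^ n) (carrier B) = {\<zero>\<^bsub>B\<^esub>}"
    using iterated_star_subgroup_trivial[OF assms(2) brace_ideal_carrier] by blast
  then have "brace_derived_series B n = {\<zero>\<^bsub>B\<^esub>}"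
    using brace_derived_series_subset[of n] zero_in_brace_derived_series[of n] by blast
  then show ?thesis unfolding brace_solvable_def by blast
qed

end
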